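(* Consider the approximate model $$\dot{x}(t) = A(Q(t))x(t) + E\Psi(s(t))\theta(t) + B I(t) + E\varepsilon(s(t)),\qquad \dot{\theta}(t)=0 \ \ \forall t\in[t_i,t_{i+1}],\qquad y(t) = Cx(t)+w(t),$$ with the data $A(\cdot),E,B,C,\Psi,\varepsilon,s,w,Q$ described in the context, and suppose that Conditions 1, 2 and 3 stated in the context hold. Let $\gamma=\rho\,\gamma_E\gamma_\theta\gamma_{\tilde\Psi}\gamma_{\tilde s}$ for some $\rho\in[0,1]$, where $\gamma_E=\|E\|$ and the other constants are those of the context. Suppose that positive constants $\alpha,\beta$ are chosen such that $\alpha\beta\ge\gamma^2$, and that the coupled linear matrix inequality and equality problem $$\begin{bmatrix} -A(Q)^\top P - PA(Q) + C^\top Z^\top + ZC - \beta I_n - W & \sqrt{\alpha}\,P\\ \sqrt{\alpha}\,P & I_n\end{bmatrix}\succeq 0\quad \forall\, Q\in\mathcal{Q},\qquad PE - C^\top F = 0,$$ has a solution for some $P\in\mathbb{S}^n_+$, $W\succeq\mathrm{diag}(\omega)$ with $\omega\in\mathbb{R}^n$, $\omega_i>0$ for all $i=1,\dots,n$, $Z\in\mathbb{R}^n$ and $F\in\mathbb{R}$ (the same $P,W,Z,F$ for all $Q\in\mathcal{Q}$). Then the adaptive observer $$\dot{\hat x}(t) = A(Q(t))\hat x(t) + E\Psi(\hat s(t))\hat\theta(t) + BI(t) + L\tilde y(t),\qquad \dot{\hat\theta}(t) = \Phi(\tilde y(t),\Psi(\hat s(t))),\qquad \hat y(t) = C\hat x(t),$$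 where $\tilde y = y-\hat y$, using the feedback gain and adaptation function $$L = P^{-1}Z,\qquad \Phi(\tilde y(t),\hat\Psi(t)) = \Lambda^{-1}\Big(\hat\Psi(t)^\top F\,\tilde y(t) - \tfrac12\sigma\,\hat\theta(t)\,\|\tilde y(t)\|\Big),\qquad \hat\Psi(t)=\Psi(\hat s(t)),$$ for some $\sigma\in\mathbb{R}^+$ and $\Lambda\in\mathbb{S}^m_+$, guarantees that the state estimation error $\tilde x = x-\hat x$ and the parameter estimation error $\tilde\theta=\theta-\hat\theta$ have uniformly ultimately bounded (UUB) dynamics.
   Context: Notation: $\mathbb{R}^+=[0,+\infty)$; $\mathbb{S}^n_+$ is the set of symmetric positive definite $n\times n$ matrices; $I_n$ is the identity; $\|\cdot\|$ is the Euclidean norm of vectors and the spectral norm $\|E\|=\sqrt{\lambda_{\max}(E^\top E)}$ of matrices. $\mathcal{C}(\Omega;\mathbb{R})$ denotes continuous functions. Model. The state is $x=[SOC,\,SOC_{\text{cell}}]^\top$, so $n=2$, with $$A(Q)=\begin{bmatrix}0&0\\ \frac{Q}{\epsilon V_{\text{cell}}} & -\frac{Q}{\epsilon V_{\text{cell}}}\end{bmatrix},\quad E=\begin{bmatrix}-\frac{1}{c_0V_{\text{res}}}\\ -\frac{1}{\epsilon c_0V_{\text{cell}}}\end{bmatrix},\quad B=\begin{bmatrix}-\frac{1}{c_0V_{\text{res}}\mathcal{F}}\\ -\frac{1}{\epsilon c_0V_{\text{cell}}\mathcal{F}}\end{bmatrix},\quad C=\begin{bmatrix}0&1\end{bmatrix},$$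 where $\epsilon,V_{\text{cell}},V_{\text{res}},c_0,\mathcal{F}$ are known positive constants. $I(t)$ is the known applied current, and $Q(t)$ is the measured volumetric flow rate, bounded with $Q_m=\inf_tQ(t)>0$ and $Q_M=\sup_tQ(t)$; $\mathcal{Q}=[Q_m,Q_M]$ is a compact set known in advance. The unknown crossover flow $Q_x\in\mathcal{C}(\Omega;\mathbb{R})$, with $\Omega\subset\mathbb{R}^k$ compact, is a function of a vector $s:\mathbb{R}^+\to\Omega$ of $k$ battery variables. It is written on each interval $[t_i,t_{i+1}]$ as $Q_x(s(t))=\Psi(s(t))\theta+\varepsilon(s(t))$, where $\theta\in\mathbb{R}^m$ is a piecewise constant (in time) vector of unknown parameters, $\Psi=[\psi_1,\dots,\psi_m]$ is a row vector of bounded basis functions $\psi_j:\overline\Omega\to\mathbb{R}$ with $\overline\Omega\supseteq\Omega$, and $\varepsilon$ is the approximation error. The consecutive intervals satisfy $\bigcup_{i\in\mathbb{N}}[t_i,t_{i+1}]=\mathbb{R}^+$. The initial conditions $x(0)=x_0$, $\theta(0)=\theta_0$ are unknown; the observer has initial conditions $\hat x(0)=\hat x_0$, $\hat\theta(0)=\hat\theta_0$. $\hat s:\mathbb{R}^+\to\overline\Omega$ is the estimate of $s$ used by the observer. The output $y(t)=\Gamma^{-1}(V_{\text{out}}(t),I(t),V_R(t))=Cx(t)+w(t)$ is obtained by inverting the voltage map $V_{\text{out}}(t)=\Gamma(SOC_{\text{cell}}(t),I(t))=E^0_{\text{cell}}+\frac{2\mathcal{R}\mathcal{T}}{\mathcal{F}}\ln\!\big(\frac{SOC_{\text{cell}}(t)}{1-SOC_{\text{cell}}(t)}\big)+V_R(SOC_{\text{cell}}(t),I(t))$,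 with $\mathcal{R},\mathcal{T},E^0_{\text{cell}}$ known constants and $V_R(SOC_{\text{cell}},0)=0$; $w$ is the measurement error. Condition 1: the functional structure of $V_R$ is such that the nonlinear mapping $\Gamma$ is globally invertible, and the inversion is such that $w$ is bounded: $\sup_t\|w(t)\|\le\bar w$ for some $\bar w\in\mathbb{R}^+$. Condition 2: there exist finite time intervals $[t_i,t_{i+1}]$, $i\in\mathbb{N}$, and bounded parameters, $\sup_t\|\theta(t)\|\le\gamma_\theta$, leading to a bounded approximation error, $\sup_t\|\varepsilon(s(t))\|\le\bar\varepsilon$, for some $\gamma_\theta,\bar\varepsilon\in\mathbb{R}^+$. Condition 3: $\Psi$ is bounded, $\sup_{t}\|\Psi(z(t))\|\le\gamma_\Psi\in\mathbb{R}^+$ for every vector function $z:\mathbb{R}^+\to\mathbb{R}^k$ (with values in the domain of $\Psi$), and satisfies the Lipschitz condition $\|\Psi(s(t))-\Psi(\hat s(t))\|\le\gamma_{\tilde\Psi}\|s(t)-\hat s(t)\|$ for some $\gamma_{\tilde\Psi}\in\mathbb{R}^+$, for all $s:\mathbb{R}^+\to\Omega$, all $\hat s:\mathbb{R}^+\to\overline\Omega\supseteq\Omega$ and all $t\in\mathbb{R}^+$. The constant $\gamma_{\tilde s}\in\mathbb{R}^+$ is such that the variables $s$ satisfy $\|\tilde s\|\le\gamma_{\tilde s}\|\tilde x\|$, where $\tilde s=s-\hat s$ and $\tilde x=x-\hat x$. UUB is meant in the standard sense (Khalil, Nonlinear Systems): the solutions of the error system are uniformly ultimately bounded if there are $b,c>0$,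 independent of the initial time $t_0\ge0$, such that for every $a\in(0,c)$ there is $T=T(a,b)\ge0$, independent of $t_0$, such that an initial error of norm at most $a$ at time $t_0$ implies that the error has norm at most $b$ for all $t\ge t_0+T$. *)

theory Defs
  imports "HOL-Analysis.Analysis"
begin

subsection \<open>Matrix inequalities\<close>

definition pos_def :: "real^'n^'n \<Rightarrow> bool" where
  "pos_def M \<longleftrightarrow> transpose M = M \<and> (\<forall>v. v \<noteq> 0 \<longrightarrow> 0 < v \<bullet> (M *v v))"

definition pos_semidef :: "real^'n^'n \<Rightarrow> bool" where
  "pos_semidef M \<longleftrightarrow> transpose M = M \<and> (\<forall>v. 0 \<le> v \<bullet> (M *v v))"

definition diag_mat :: "real^'n \<Rightarrow> real^'n^'n" where
  "diag_mat d = (\<chi> i j. if i = j then d $ i else 0)"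

definition block_mat ::
  "real^'n^'n \<Rightarrow> real^'m^'n \<Rightarrow> real^'n^'m \<Rightarrow> real^'m^'m \<Rightarrow> real^('n + 'm)^('n + 'm)" where
  "block_mat M11 M12 M21 M22 = (\<chi> i j.
     case i of
       Inl a \<Rightarrow> (case j of Inl b \<Rightarrow> M11 $ a $ b | Inr b \<Rightarrow> M12 $ a $ b)
     | Inr a \<Rightarrow> (case j of Inl b \<Rightarrow> M21 $ a $ b | Inr b \<Rightarrow> M22 $ a $ b))"

(* The product of a column u and a row v^T. *)
definition col_row :: "real^'n \<Rightarrow> real^'m \<Rightarrow> real^'m^'n" where
  "col_row u v = (columnvector u :: real^1^'n) ** (rowvector v :: real^'m^1)"


subsection \<open>Battery model\<close>

text \<open>
  The columns E, B and the row C are represented by vectors: the scalar C x is the inner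
  product of C and x, and the spectral norm of the column E is its Euclidean norm.  Likewise the
  row \<Psi>(z) of basis functions is a vector, and \<Psi>(z) \<theta> is an inner product.
\<close>

definition A_mat :: "real \<Rightarrow> real \<Rightarrow> real \<Rightarrow> real^2^2" where
  "A_mat por Vcell q =
     vector [vector [0, 0], vector [q / (por * Vcell), - (q / (por * Vcell))]]"

definition E_vec :: "real \<Rightarrow> real \<Rightarrow> real \<Rightarrow> real \<Rightarrow> real^2" where
  "E_vec por Vcell Vres c0 = vector [- 1 / (c0 * Vres), - 1 / (por * c0 * Vcell)]"

definition B_vec :: "real \<Rightarrow> real \<Rightarrow> real \<Rightarrow> real \<Rightarrow> real \<Rightarrow> real^2" where
  "B_vec por Vcell Vres c0 Far =
     vector [- 1 / (c0 * Vres * Far), - 1 / (por * c0 * Vcell * Far)]"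

definition C_vec :: "real^2" where
  "C_vec = vector [0, 1]"

(* The voltage map: state of charge z in the open interval (0,1), current i. *)
definition voltage ::
  "real \<Rightarrow> real \<Rightarrow> real \<Rightarrow> real \<Rightarrow> (real \<Rightarrow> real \<Rightarrow> real) \<Rightarrow> real \<Rightarrow> real \<Rightarrow> real" where
  "voltage E0 R Temp Far VR z i = E0 + 2 * R * Temp / Far * ln (z / (1 - z)) + VR z i"

definition voltage_inv ::
  "real \<Rightarrow> real \<Rightarrow> real \<Rightarrow> real \<Rightarrow> (real \<Rightarrow> real \<Rightarrow> real) \<Rightarrow> real \<Rightarrow> real \<Rightarrow> real" where
  "voltage_inv E0 R Temp Far VR V i =
     inv_into {0<..<1} (\<lambda>z. voltage E0 R Temp Far VR z i) V"

(* Globally invertible: at every current, every voltage is attained at exactly one state of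
   charge in (0,1). *)
definition voltage_invertible ::
  "real \<Rightarrow> real \<Rightarrow> real \<Rightarrow> real \<Rightarrow> (real \<Rightarrow> real \<Rightarrow> real) \<Rightarrow> bool" where
  "voltage_invertible E0 R Temp Far VR \<longleftrightarrow>
     (\<forall>i. bij_betw (\<lambda>z. voltage E0 R Temp Far VR z i) {0<..<1} UNIV)"

(* The function epsilon in Qx = Psi theta + epsilon; it depends on the parameter value theta that
   is in force, hence on the time interval. *)
definition approx_err ::
  "(real^'k \<Rightarrow> real) \<Rightarrow> (real^'k \<Rightarrow> real^'m) \<Rightarrow> real^'m \<Rightarrow> real^'k \<Rightarrow> real" where
  "approx_err Qx Psi th z = Qx z - Psi z \<bullet> th"


subsection \<open>Solutions, observer and ultimate boundedness\<close>

text \<open>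
  A solution on \<open>[t0, \<infinity>)\<close> of an equation whose right-hand side is discontinuous in time (it
  contains the piecewise constant \<theta> and the signals Q, I, s, w): a continuous function
  satisfying the equation except at exceptional times, finitely many in each bounded interval.
  The argument \<open>f\<close> is the right-hand side evaluated along the solution.
\<close>

definition solves_from :: "real \<Rightarrow> (real \<Rightarrow> 'a::real_normed_vector) \<Rightarrow> (real \<Rightarrow> 'a) \<Rightarrow> bool" where
  "solves_from t0 f z \<longleftrightarrow> continuous_on {t0..} z \<and>
     (\<exists>D. (\<forall>t1. finite (D \<inter> {t0..t1})) \<and>
          (\<forall>t \<in> {t0..} - D. (z has_vector_derivative f t) (at t within {t0..})))"

text \<open>
  Uniform ultimate boundedness; \<open>S t0\<close> is the set of solutions of the error system that start
  at time \<open>t0\<close>.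
\<close>

definition UUB :: "(real \<Rightarrow> (real \<Rightarrow> 'a::real_normed_vector) set) \<Rightarrow> bool" where
  "UUB S \<longleftrightarrow> (\<exists>b>0. \<exists>c>0. \<forall>a. 0 < a \<and> a < c \<longrightarrow>
     (\<exists>T\<ge>0. \<forall>t0\<ge>0. \<forall>e \<in> S t0. norm (e t0) \<le> a \<longrightarrow> (\<forall>t \<ge> t0 + T. norm (e t) \<le> b)))"

definition adaptation ::
  "real^'m^'m \<Rightarrow> real \<Rightarrow> real \<Rightarrow> real \<Rightarrow> real^'m \<Rightarrow> real^'m \<Rightarrow> real^'m" where
  "adaptation Lam sig F ytil Psih thetah =
     matrix_inv Lam *v ((F * ytil) *\<^sub>R Psih - (1/2 * sig * \<bar>ytil\<bar>) *\<^sub>R thetah)"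

(* x' = A x + E Psi(s) theta + B I + E epsilon(s) *)
definition plant_rhs ::
  "(real \<Rightarrow> real^2^2) \<Rightarrow> real^2 \<Rightarrow> real^2 \<Rightarrow> (real^'k \<Rightarrow> real) \<Rightarrow> (real^'k \<Rightarrow> real^'m) \<Rightarrow>
   (real \<Rightarrow> real) \<Rightarrow> (real \<Rightarrow> real) \<Rightarrow> (real \<Rightarrow> real^'k) \<Rightarrow> (real \<Rightarrow> real^'m) \<Rightarrow>
   (real \<Rightarrow> real^2) \<Rightarrow> real \<Rightarrow> real^2" where
  "plant_rhs A E B Qx Psi Q I s theta x t =
     A (Q t) *v x t + (Psi (s t) \<bullet> theta t) *\<^sub>R E + I t *\<^sub>R B
       + approx_err Qx Psi (theta t) (s t) *\<^sub>R E"

(* xh' = A xh + E Psi(sh) thetah + B I + L (y - C xh) *)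
definition observer_rhs ::
  "(real \<Rightarrow> real^2^2) \<Rightarrow> real^2 \<Rightarrow> real^2 \<Rightarrow> real^2 \<Rightarrow> real^2 \<Rightarrow> (real^'k \<Rightarrow> real^'m) \<Rightarrow>
   (real \<Rightarrow> real) \<Rightarrow> (real \<Rightarrow> real) \<Rightarrow> (real \<Rightarrow> real^'k) \<Rightarrow> (real \<Rightarrow> real) \<Rightarrow>
   (real \<Rightarrow> real^2) \<Rightarrow> (real \<Rightarrow> real^'m) \<Rightarrow> real \<Rightarrow> real^2" where
  "observer_rhs A E B C L Psi Q I sh y xh thetah t =
     A (Q t) *v xh t + (Psi (sh t) \<bullet> thetah t) *\<^sub>R E + I t *\<^sub>R B
       + (y t - C \<bullet> xh t) *\<^sub>R L"

text \<open>
  The solutions (state error, parameter error) of the error system on \<open>[t0, \<infinity>)\<close>: the exogenous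
  signals Q, I, s, w, \<theta> are given, while the plant and observer states, the observer's estimate
  \<open>sh\<close> of s, the measured voltage \<open>Vout\<close> and the output \<open>y\<close> belong to the solution.
  The map \<open>Vinv\<close> recovers the output from the measured voltage and the current.  The measured
  voltage is not required to equal the model voltage at the true state of charge (that would
  force w = 0): the resulting discrepancy in y is what w denotes.
\<close>

definition error_solutions ::
  "(real \<Rightarrow> real^2^2) \<Rightarrow> real^2 \<Rightarrow> real^2 \<Rightarrow> real^2 \<Rightarrow>
   (real^'k \<Rightarrow> real) \<Rightarrow> (real^'k \<Rightarrow> real^'m) \<Rightarrow> (real^'k) set \<Rightarrow> real \<Rightarrow>
   (real \<Rightarrow> real) \<Rightarrow> (real \<Rightarrow> real) \<Rightarrow> (real \<Rightarrow> real^'k) \<Rightarrow> (real \<Rightarrow> real) \<Rightarrow> (real \<Rightarrow> real^'m) \<Rightarrow>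
   (real \<Rightarrow> real \<Rightarrow> real) \<Rightarrow> real^2 \<Rightarrow> real^'m^'m \<Rightarrow> real \<Rightarrow> real \<Rightarrow>
   real \<Rightarrow> (real \<Rightarrow> (real^2) \<times> (real^'m)) set" where
  "error_solutions A E B C Qx Psi Obar g_s Q I s w theta Vinv L Lam sig F t0 =
     {\<lambda>t. (x t - xh t, theta t - thetah t) | x xh thetah sh y Vout.
        solves_from t0 (plant_rhs A E B Qx Psi Q I s theta x) x \<and>
        (\<forall>t\<ge>t0. y t = Vinv (Vout t) (I t) \<and> y t = C \<bullet> x t + w t) \<and>
        sh \<in> {t0..} \<rightarrow> Obar \<and>
        (\<forall>t\<ge>t0. norm (s t - sh t) \<le> g_s * norm (x t - xh t)) \<and>
        solves_from t0 (observer_rhs A E B C L Psi Q I sh y xh thetah) xh \<and>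
        solves_from t0
          (\<lambda>t. adaptation Lam sig F (y t - C \<bullet> xh t) (Psi (sh t)) (thetah t)) thetah}"

end

theory Submission
  imports Defs
begin

text \<open>
  The two parts of the error system can be bounded one after the other, because the estimate
  \<theta>h, unlike the parameter error, has an equation that bounds \<theta>h whatever the state does.
  With \<open>yt\<close> the output error and \<open>p = \<Psi>(sh)\<close>, the adaptation law gives

    \<open>(d/dt) \<theta>h\<^sup>T \<Lambda> \<theta>h = 2 F yt (p \<bullet> \<theta>h) - \<sigma> \<bar>yt\<bar> \<parallel>\<theta>h\<parallel>\<^sup>2
       \<le> \<bar>yt\<bar> \<parallel>\<theta>h\<parallel> (2 \<bar>F\<bar> g_Psi - \<sigma> \<parallel>\<theta>h\<parallel>)\<close>.

  Both terms carry the factor \<open>\<bar>yt\<bar>\<close>, so the right-hand side is nonpositive as soon as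
  \<open>\<parallel>\<theta>h\<parallel> \<ge> 2 \<bar>F\<bar> g_Psi / \<sigma>\<close>, even if \<open>yt\<close> is unbounded or vanishes
  (\<open>adaptation_inward\<close>).  Hence \<open>\<theta>h\<close> is trapped in a ball, and this is unaffected by the jumps
  of \<theta>, since \<open>\<theta>h\<close> itself is continuous.

  The state error \<open>v\<close> then obeys \<open>v' = (A(Q) - L C\<^sup>T) v + c E - w L\<close>, where
  \<open>c = \<Psi>(s) \<bullet> \<theta> + \<epsilon> - \<Psi>(sh) \<bullet> \<theta>h\<close> is bounded because \<Psi>, \<theta>, \<epsilon> and now \<open>\<theta>h\<close> are.
  The matrix inequality makes \<open>v\<^sup>T P v\<close> decrease at rate at least \<open>\<beta> \<parallel>v\<parallel>\<^sup>2\<close> along the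
  homogeneous part (\<open>observer_lyapunov_decrease\<close>); this beats the disturbance, which contributes
  at most a multiple of \<open>\<parallel>v\<parallel>\<close>, once \<open>\<parallel>v\<parallel>\<close> is large (\<open>decrease_with_disturbance\<close>).
  So \<open>v\<close> is trapped too.

  Both steps use the same principle (\<open>solves_from_trapped\<close>): if a quadratic Lyapunov function does
  not increase outside a ball, then a solution starting in the ball stays in a ball larger by a
  fixed factor.  All bounds are uniform in the initial time and in the solution, so
  trajectories starting with an error of norm less than 1 satisfy the ultimate bound with \<open>T = 0\<close>.
\<close>

section \<open>Trapping by a Lyapunov function\<close>

text \<open>
  Look at the last time before \<open>t\<close> at which \<open>V\<close> is at most \<open>M\<close>: after it \<open>V\<close> exceeds \<open>M\<close>
  and therefore cannot increase.  As \<open>V\<close> may fail to be differentiable at exceptional times, the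
  mean value theorem is replaced by the fundamental theorem of calculus for the gauge integral,
  which allows finitely many of them.
\<close>

lemma barrier:
  fixes V V' :: "real \<Rightarrow> real"
  assumes cont: "continuous_on {t0..} V"
    and fin: "\<And>t1. finite (D \<inter> {t0..t1})"
    and der: "\<And>t. t \<in> {t0..} - D \<Longrightarrow> (V has_vector_derivative V' t) (at t within {t0..})"
    and decr: "\<And>t. t0 \<le> t \<Longrightarrow> M \<le> V t \<Longrightarrow> V' t \<le> 0"
    and init: "V t0 \<le> M" and "t0 \<le> t"
  shows "V t \<le> M"
proof (rule ccontr)
  assume "\<not> V t \<le> M"
  define S where "S = {t0..t} \<inter> V -` {..M}"
  have "closed S"
    unfolding S_def
    by (intro continuous_closed_preimage continuous_on_subset[OF cont]) auto
  moreover have "bounded S"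
    unfolding S_def by (rule bounded_subset[of "{t0..t}"]) auto
  ultimately have "compact S" by (simp add: compact_eq_bounded_closed)
  moreover have "t0 \<in> S" using init \<open>t0 \<le> t\<close> by (simp add: S_def)
  ultimately obtain r where r: "r \<in> S" "\<And>u. u \<in> S \<Longrightarrow> u \<le> r"
    using compact_attains_sup[of S] by blast
  have rt: "t0 \<le> r" "r \<le> t" "V r \<le> M" using r(1) by (auto simp: S_def)
  have above: "M \<le> V u" if "r < u" "u \<le> t" for u
    using r(2)[of u] that rt(1) by (force simp: S_def)
  \<comment> \<open>The derivative of \<open>- V\<close>, made nonnegative also at \<open>r\<close> and at the exceptional times.\<close>
  define G where "G u = (if u \<in> D \<or> u \<le> r then 0 else - V' u)" for u
  have "(G has_integral (- V t - (- V r))) {r..t}"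
  proof (rule fundamental_theorem_of_calculus_interior_strong[of "D \<inter> {t0..t}"])
    show "continuous_on {r..t} (\<lambda>u. - V u)"
      using rt by (intro continuous_on_minus continuous_on_subset[OF cont]) auto
    fix u assume u: "u \<in> {r<..<t} - D \<inter> {t0..t}"
    then have "u \<in> {t0..} - D" and G: "G u = - V' u" and "t0 < u"
      using rt by (auto simp: G_def)
    then have "(V has_vector_derivative V' u) (at u within {t0<..})"
      by (intro has_vector_derivative_within_subset[OF der]) auto
    then have "(V has_vector_derivative V' u) (at u)"
      using \<open>t0 < u\<close> at_within_open[of u "{t0<..}"] by simp
    then show "((\<lambda>u. - V u) has_vector_derivative G u) (at u)"
      unfolding G by (rule has_vector_derivative_minus)
  qed (use fin rt in auto)
  moreover have "0 \<le> G u" if "u \<in> {r..t}" for u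
    using decr[of u] above[of u] that rt by (auto simp: G_def)
  ultimately have "0 \<le> - V t - (- V r)" by (rule has_integral_nonneg)
  with rt \<open>\<not> V t \<le> M\<close> show False by simp
qed

lemma pos_def_bounds:
  fixes M :: "real^'n^'n"
  assumes "pos_def M"
  obtains k K where "0 < k" "0 < K"
    "\<And>v. k * (norm v)\<^sup>2 \<le> v \<bullet> (M *v v)" "\<And>v. v \<bullet> (M *v v) \<le> K * (norm v)\<^sup>2"
proof -
  have "continuous_on (sphere 0 1) (\<lambda>v. v \<bullet> (M *v v))"
    by (intro continuous_intros matrix_vector_mult_linear_continuous_on)
  moreover have "axis undefined 1 \<in> (sphere 0 1 :: (real^'n) set)"
    by simp
  ultimately obtain u where u: "u \<in> sphere 0 1"
      "\<And>v. v \<in> sphere 0 1 \<Longrightarrow> u \<bullet> (M *v u) \<le> v \<bullet> (M *v v)"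
    using continuous_attains_inf[OF compact_sphere, of 0 1 "\<lambda>v. v \<bullet> (M *v v)"]
    by (metis empty_iff)
  have "u \<noteq> 0" using u(1) by auto
  then have pos: "0 < u \<bullet> (M *v u)" using assms by (simp add: pos_def_def)
  have low: "u \<bullet> (M *v u) * (norm v)\<^sup>2 \<le> v \<bullet> (M *v v)" for v
  proof (cases "v = 0")
    case False
    then have "u \<bullet> (M *v u) \<le> (inverse (norm v) *\<^sub>R v) \<bullet> (M *v (inverse (norm v) *\<^sub>R v))"
      by (intro u(2)) simp
    also have "\<dots> = (v \<bullet> (M *v v)) / (norm v)\<^sup>2"
      by (simp add: matrix_vector_mult_scaleR power2_eq_square divide_inverse)
    finally show ?thesis using False by (simp add: field_simps)
  qed simp
  obtain K where K: "0 < K" "\<And>v. norm (M *v v) \<le> norm v * K"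
    using bounded_linear.pos_bounded[OF matrix_vector_mul_bounded_linear[of M]] by blast
  have "v \<bullet> (M *v v) \<le> K * (norm v)\<^sup>2" for v
  proof -
    have "v \<bullet> (M *v v) \<le> norm v * norm (M *v v)" by (rule norm_cauchy_schwarz)
    also have "\<dots> \<le> norm v * (norm v * K)" by (intro mult_left_mono K) simp
    finally show ?thesis by (simp add: power2_eq_square mult_ac)
  qed
  with pos low K show thesis by (intro that)
qed

lemma pos_def_mult_inverse:
  fixes M :: "real^'n^'n"
  assumes "pos_def M"
  shows "M *v (matrix_inv M *v v) = v"
proof -
  have "u = 0" if "M *v u = 0" for u
    using assms that by (metis inner_zero_right less_irrefl pos_def_def)
  then have "invertible M"
    by (simp add: invertible_left_inverse matrix_left_invertible_ker)
  then have "M ** matrix_inv M = mat 1"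
    unfolding invertible_def matrix_inv_def by (metis (mono_tags, lifting) someI_ex)
  then show ?thesis
    by (simp add: matrix_vector_mul_assoc)
qed

lemma pos_def_symmetric:
  assumes "pos_def M"
  shows "u \<bullet> (M *v v) = v \<bullet> (M *v u)"
  using assms by (metis dot_lmul_matrix inner_commute pos_def_def transpose_matrix_vector)

text \<open>
  The sublevel sets of the quadratic form of \<open>M\<close> are ellipsoids; one of them contains the ball of
  radius \<open>r\<close>, cannot be left because the form does not increase outside that ball, and lies in the ball of
  radius \<open>g * r\<close>.  The factor \<open>g\<close>, the square root of the ratio of an upper to a lower bound of the
  form on the unit sphere, depends on \<open>M\<close> only, which is what makes the conclusion
  uniform over equations, initial times and solutions.
\<close>

lemma solves_from_trapped:
  fixes M :: "real^'n^'n"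
  assumes "pos_def M"
  obtains g where "0 < g"
    "\<And>r t0 f z t. solves_from t0 f z \<Longrightarrow> norm (z t0) \<le> r \<Longrightarrow>
       (\<And>t. t0 \<le> t \<Longrightarrow> r \<le> norm (z t) \<Longrightarrow> z t \<bullet> (M *v f t) \<le> 0) \<Longrightarrow>
       t0 \<le> t \<Longrightarrow> norm (z t) \<le> g * r"
proof -
  obtain k K where kK: "0 < k" "0 < K"
    "\<And>v. k * (norm v)\<^sup>2 \<le> v \<bullet> (M *v v)" "\<And>v. v \<bullet> (M *v v) \<le> K * (norm v)\<^sup>2"
    using pos_def_bounds[OF assms] by blast
  show thesis
  proof (rule that[of "sqrt (K / k)"])
    show "0 < sqrt (K / k)" using kK(1,2) by simp
    fix r t0 t and f z :: "real \<Rightarrow> real^'n"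
    assume sol: "solves_from t0 f z" and init: "norm (z t0) \<le> r" and "t0 \<le> t"
      and inward: "\<And>t. t0 \<le> t \<Longrightarrow> r \<le> norm (z t) \<Longrightarrow> z t \<bullet> (M *v f t) \<le> 0"
    have "0 \<le> r" using init norm_ge_zero[of "z t0"] by linarith
    from sol obtain D where cont: "continuous_on {t0..} z"
      and D: "\<And>t1. finite (D \<inter> {t0..t1})"
      and der: "\<And>t. t \<in> {t0..} - D \<Longrightarrow> (z has_vector_derivative f t) (at t within {t0..})"
      by (auto simp: solves_from_def)
    have "z t \<bullet> (M *v z t) \<le> K * r\<^sup>2"
    proof (rule barrier[where V = "\<lambda>t. z t \<bullet> (M *v z t)" and D = D and V' = "\<lambda>t. 2 * (z t \<bullet> (M *v f t))"])
      show "continuous_on {t0..} (\<lambda>t. z t \<bullet> (M *v z t))"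
        using cont by (intro continuous_on_inner
            continuous_on_compose2[OF matrix_vector_mult_linear_continuous_on[of UNIV M]]) auto
      fix u
      show "((\<lambda>t. z t \<bullet> (M *v z t)) has_vector_derivative 2 * (z u \<bullet> (M *v f u)))
              (at u within {t0..})" if "u \<in> {t0..} - D"
        using bounded_bilinear.has_vector_derivative[OF bounded_bilinear_inner der[OF that]
            bounded_linear.has_vector_derivative[OF matrix_vector_mul_bounded_linear[of M]
              der[OF that]]]
        by (simp add: pos_def_symmetric[OF assms, of "f u" "z u"])
      show "2 * (z u \<bullet> (M *v f u)) \<le> 0" if "t0 \<le> u" "K * r\<^sup>2 \<le> z u \<bullet> (M *v z u)"
      proof -
        have "K * r\<^sup>2 \<le> K * (norm (z u))\<^sup>2" using that(2) kK(4)[of "z u"] by linarith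
        then have "r\<^sup>2 \<le> (norm (z u))\<^sup>2" using kK(2) by simp
        then have "r \<le> norm (z u)" by (rule power2_le_imp_le) simp
        then show ?thesis using inward[OF that(1)] by simp
      qed
    next
      have "K * (norm (z t0))\<^sup>2 \<le> K * r\<^sup>2"
        using kK(2) init by (intro mult_left_mono power_mono) auto
      then show "z t0 \<bullet> (M *v z t0) \<le> K * r\<^sup>2" using kK(4)[of "z t0"] by linarith
    qed (use D \<open>t0 \<le> t\<close> in auto)
    then have "k * (norm (z t))\<^sup>2 \<le> K * r\<^sup>2" using kK(3)[of "z t"] by linarith
    then have "(norm (z t))\<^sup>2 \<le> (sqrt (K / k) * r)\<^sup>2"
      using kK(1,2) by (simp add: field_simps power_mult_distrib)
    moreover have "0 \<le> sqrt (K / k) * r" using kK(1,2) \<open>0 \<le> r\<close> by simp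
    ultimately show "norm (z t) \<le> sqrt (K / k) * r" by (rule power2_le_imp_le)
  qed
qed

section \<open>Solutions and block matrices\<close>

lemma solves_from_diff:
  assumes "solves_from t0 f x" "solves_from t0 g y"
  shows "solves_from t0 (\<lambda>t. f t - g t) (\<lambda>t. x t - y t)"
proof -
  obtain D D' where "\<And>t1. finite (D \<inter> {t0..t1})" "\<And>t1. finite (D' \<inter> {t0..t1})"
    "\<And>t. t \<in> {t0..} - D \<Longrightarrow> (x has_vector_derivative f t) (at t within {t0..})"
    "\<And>t. t \<in> {t0..} - D' \<Longrightarrow> (y has_vector_derivative g t) (at t within {t0..})"
    using assms unfolding solves_from_def by metis
  then show ?thesis
    using assms unfolding solves_from_def
    by (intro conjI continuous_on_diff exI[of _ "D \<union> D'"])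
       (auto simp: Int_Un_distrib2 intro!: has_vector_derivative_diff)
qed

lemma pos_semidef_block_mat_upper_left:
  fixes M11 :: "real^'n^'n" and M22 :: "real^'m^'m"
  assumes "pos_semidef (block_mat M11 M12 M21 M22)"
  shows "0 \<le> v \<bullet> (M11 *v v)"
proof -
  define u :: "real^('n + 'm)" where "u = (\<chi> i. case i of Inl a \<Rightarrow> v $ a | Inr a \<Rightarrow> 0)"
  have "u \<bullet> (block_mat M11 M12 M21 M22 *v u) = v \<bullet> (M11 *v v)"
    by (simp add: inner_vec_def matrix_vector_mult_def block_mat_def u_def
        UNIV_Plus_UNIV[symmetric] sum.Plus del: UNIV_Plus_UNIV)
  then show ?thesis using assms by (metis pos_semidef_def)
qed

lemma col_row_mult_vec: "col_row u v *v x = (v \<bullet> x) *\<^sub>R u"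
  by (simp add: vec_eq_iff col_row_def columnvector_def rowvector_def matrix_vector_mult_def
      matrix_matrix_mult_def inner_vec_def sum_distrib_left mult_ac)

lemma inner_diag_mat: "v \<bullet> (diag_mat d *v v) = (\<Sum>i\<in>UNIV. d $ i * (v $ i)\<^sup>2)"
  by (simp add: inner_vec_def matrix_vector_mult_def diag_mat_def if_distrib[of "\<lambda>x. x * _"]
      if_distrib[of "\<lambda>x. _ * x"] power2_eq_square mult_ac cong: if_cong)

section \<open>The two parts of the error system\<close>

text \<open>
  The upper left block of the matrix inequality is \<open>- \<beta>\<close> minus the Lyapunov operator of the closed
  loop \<open>M - L C\<^sup>T\<close> minus the positive matrix \<open>W\<close>: the gain is chosen so that
  \<open>P L = Z\<close>, which turns the terms \<open>C\<^sup>T Z\<^sup>T + Z C\<close> into the contribution of the output injection.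
\<close>

lemma observer_lyapunov_decrease:
  fixes M P W :: "real^'n^'n"
  assumes "pos_semidef (block_mat
      (- (transpose M ** P) - P ** M + col_row C Z + col_row Z C - beta *\<^sub>R mat 1 - W) M12 M21 M22)"
    and "pos_semidef (W - diag_mat omega)" "\<forall>i. omega $ i > 0"
    and "pos_def P" "L = matrix_inv P *v Z"
  shows "2 * (v \<bullet> (P *v (M *v v - (C \<bullet> v) *\<^sub>R L))) \<le> - beta * (norm v)\<^sup>2"
proof -
  have "0 \<le> v \<bullet> (diag_mat omega *v v)"
    using assms(3) by (simp add: inner_diag_mat sum_nonneg less_imp_le)
  also have "\<dots> \<le> v \<bullet> (W *v v)"
    using assms(2) by (simp add: pos_semidef_def matrix_vector_mult_diff_rdistrib inner_diff_right)
  finally have "0 \<le> v \<bullet> (W *v v)" .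
  moreover have "v \<bullet> ((transpose M ** P) *v v) = v \<bullet> ((P ** M) *v v)"
    by (metis assms(4) dot_lmul_matrix inner_commute matrix_vector_mul_assoc pos_def_symmetric
        transpose_matrix_vector)
  moreover have "P *v L = Z" using assms(4,5) by (simp add: pos_def_mult_inverse)
  moreover note pos_semidef_block_mat_upper_left[OF assms(1), of v]
  moreover have "(- N) *v v = - (N *v v)" for N :: "real^'n^'n"
    using matrix_vector_mult_diff_rdistrib[of 0 N v] by simp
  ultimately show ?thesis
    by (simp add: matrix_vector_mult_diff_rdistrib matrix_vector_mult_add_rdistrib
        inner_diff_right inner_add_right col_row_mult_vec matrix_vector_mult_diff_distrib
        matrix_vector_mult_scaleR scaleR_matrix_vector_assoc[symmetric] matrix_vector_mul_assoc
        dot_square_norm inner_commute[of v C] inner_commute[of v Z])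
qed

text \<open>
  The driving term and the leakage of the adaptation law are both proportional to the size of the
  output error \<open>yt\<close>, so which of them dominates depends on the norm of \<open>h\<close> alone.
\<close>

lemma adaptation_inward:
  assumes "pos_def Lam" "0 < sig" "norm p \<le> g" "2 * \<bar>F\<bar> * g / sig \<le> norm h"
  shows "h \<bullet> (Lam *v adaptation Lam sig F yt p h) \<le> 0"
proof -
  have "F * yt * (h \<bullet> p) \<le> \<bar>F * yt\<bar> * \<bar>h \<bullet> p\<bar>"
    by (metis abs_ge_self abs_mult)
  also have "\<dots> \<le> \<bar>F * yt\<bar> * (norm h * norm p)"
    by (intro mult_left_mono Cauchy_Schwarz_ineq2) simp
  also have "\<dots> \<le> \<bar>F * yt\<bar> * (norm h * g)"
    using assms(3) by (intro mult_left_mono) auto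
  also have "\<dots> = \<bar>yt\<bar> * norm h * (\<bar>F\<bar> * g)"
    by (simp add: abs_mult mult_ac)
  also have "\<dots> \<le> \<bar>yt\<bar> * norm h * (1/2 * sig * norm h)"
    using assms(2,4) by (intro mult_left_mono) (auto simp: field_simps)
  finally have "F * yt * (h \<bullet> p) \<le> 1/2 * sig * \<bar>yt\<bar> * (norm h)\<^sup>2"
    by (simp add: power2_eq_square mult_ac)
  then show ?thesis
    by (simp add: adaptation_def pos_def_mult_inverse[OF assms(1)] inner_diff_right
        dot_square_norm)
qed

text \<open>
  The disturbance \<open>d\<close> enters the derivative of the Lyapunov function linearly in \<open>v\<close>, the decay
  quadratically; they balance at radius \<open>2 * kap / beta\<close>.
\<close>

lemma decrease_with_disturbance:
  fixes P :: "real^'n^'n"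
  assumes decr: "2 * (v \<bullet> (P *v a)) \<le> - beta * (norm v)\<^sup>2"
    and dist: "norm (P *v d) \<le> kap" and "0 < beta" "2 * kap / beta \<le> norm v"
  shows "v \<bullet> (P *v (a + d)) \<le> 0"
proof -
  have "v \<bullet> (P *v d) \<le> norm v * kap"
    using norm_cauchy_schwarz[of v "P *v d"] mult_left_mono[OF dist, of "norm v"] by simp
  also have "2 * \<dots> \<le> norm v * (beta * norm v)"
    using assms(3,4) mult_left_mono[of "2 * kap" "beta * norm v" "norm v"]
    by (simp add: field_simps)
  finally show ?thesis
    using decr by (simp add: matrix_vector_right_distrib inner_add_right power2_eq_square mult_ac)
qed

section \<open>Ultimate boundedness\<close>

theorem theorem1:
  fixes por Vcell Vres c0 Far :: real
    and E0 R Temp :: real and VR :: "real \<Rightarrow> real \<Rightarrow> real"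
    and Q I w :: "real \<Rightarrow> real"
    and Omega Obar :: "(real^'k) set" and s :: "real \<Rightarrow> real^'k"
    and Qx :: "real^'k \<Rightarrow> real" and Psi :: "real^'k \<Rightarrow> real^'m"
    and tk :: "nat \<Rightarrow> real" and theta :: "real \<Rightarrow> real^'m"
    and Qm QM wbar g_theta epsbar g_Psi g_lip g_s rho gam alpha beta F sig :: real
    and A :: "real \<Rightarrow> real^2^2" and E B C Z L omega :: "real^2"
    and P W :: "real^2^2" and Lam :: "real^'m^'m"
  assumes positive_params: "por > 0" "Vcell > 0" "Vres > 0" "c0 > 0" "Far > 0"
    and model: "A = A_mat por Vcell" "E = E_vec por Vcell Vres c0"
               "B = B_vec por Vcell Vres c0 Far" "C = C_vec"
    and flow: "bdd_below (Q ` {0..})" "bdd_above (Q ` {0..})"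
              "Qm = (INF t\<in>{0..}. Q t)" "QM = (SUP t\<in>{0..}. Q t)" "Qm > 0"
    and crossover: "compact Omega" "Omega \<subseteq> Obar" "continuous_on Omega Qx"
                   "s \<in> {0..} \<rightarrow> Omega"
    and cond1: "\<forall>z\<in>{0<..<1}. VR z 0 = 0" "voltage_invertible E0 R Temp Far VR"
               "wbar \<ge> 0" "\<forall>t\<ge>0. \<bar>w t\<bar> \<le> wbar"
    and cond2: "strict_mono tk" "(\<Union>i. {tk i..tk (Suc i)}) = {0..}"
               "\<forall>i. theta constant_on {tk i..<tk (Suc i)}"
               "g_theta \<ge> 0" "\<forall>t\<ge>0. norm (theta t) \<le> g_theta"
               "epsbar \<ge> 0" "\<forall>t\<ge>0. \<bar>approx_err Qx Psi (theta t) (s t)\<bar> \<le> epsbar"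
    and cond3: "g_Psi \<ge> 0"
               "\<forall>z \<in> {0::real..} \<rightarrow> Obar. \<forall>t\<ge>0. norm (Psi (z t)) \<le> g_Psi"
               "g_lip \<ge> 0"
               "\<forall>z \<in> {0::real..} \<rightarrow> Omega. \<forall>zh \<in> {0::real..} \<rightarrow> Obar. \<forall>t\<ge>0.
                  norm (Psi (z t) - Psi (zh t)) \<le> g_lip * norm (z t - zh t)"
    and g_s: "g_s \<ge> 0"
    and gam: "0 \<le> rho" "rho \<le> 1" "gam = rho * norm E * g_theta * g_lip * g_s"
    and alpha_beta: "alpha > 0" "beta > 0" "alpha * beta \<ge> gam\<^sup>2"
    and lmi: "\<forall>q\<in>{Qm..QM}. pos_semidef (block_mat
                 (- (transpose (A q) ** P) - P ** A q + col_row C Z + col_row Z C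
                    - beta *\<^sub>R mat 1 - W)
                 (sqrt alpha *\<^sub>R P)
                 (sqrt alpha *\<^sub>R P)
                 (mat 1 :: real^2^2))"
    and lme: "P *v E - F *\<^sub>R C = 0"
    and P: "pos_def P"
    and W: "\<forall>i. omega $ i > 0" "pos_semidef (W - diag_mat omega)"
    and gain: "L = matrix_inv P *v Z"
    and design: "sig > 0" "pos_def Lam"
  shows "UUB (error_solutions A E B C Qx Psi Obar g_s Q I s w theta
                (voltage_inv E0 R Temp Far VR) L Lam sig F)"
proof -
  have Psi_bound: "norm (Psi z) \<le> g_Psi" if "z \<in> Obar" for z
    using cond3(2)[rule_format, of "\<lambda>_. z" 0] that by simp
  obtain g1 where g1: "0 < g1" and trap1:
    "\<And>r t0 f z t. solves_from t0 f z \<Longrightarrow> norm (z t0) \<le> r \<Longrightarrow>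
       (\<And>t. t0 \<le> t \<Longrightarrow> r \<le> norm (z t) \<Longrightarrow> z t \<bullet> (Lam *v f t) \<le> 0) \<Longrightarrow>
       t0 \<le> t \<Longrightarrow> norm (z t) \<le> g1 * r"
    using solves_from_trapped[OF design(2)] by blast
  obtain g2 where g2: "0 < g2" and trap2:
    "\<And>r t0 f z t. solves_from t0 f z \<Longrightarrow> norm (z t0) \<le> r \<Longrightarrow>
       (\<And>t. t0 \<le> t \<Longrightarrow> r \<le> norm (z t) \<Longrightarrow> z t \<bullet> (P *v f t) \<le> 0) \<Longrightarrow>
       t0 \<le> t \<Longrightarrow> norm (z t) \<le> g2 * r"
    using solves_from_trapped[OF P] by blast
  \<comment> \<open>Radius of the estimate: the initial estimate has norm at most \<open>1 + g_theta\<close>, as the initial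
      error has norm at most 1.\<close>
  define H where "H = g1 * max (1 + g_theta) (2 * \<bar>F\<bar> * g_Psi / sig)"
  \<comment> \<open>Bounds for the coefficient of \<open>E\<close> in the state error equation, and for the disturbance.\<close>
  define del where "del = g_Psi * g_theta + epsbar + g_Psi * H"
  define kap where "kap = del * norm (P *v E) + wbar * norm (P *v L)"
  define X where "X = g2 * max 1 (2 * kap / beta)"
  have "0 \<le> H"
    using g1 cond2(4) by (simp add: H_def le_max_iff_disj)
  have "0 < X"
    unfolding X_def using g2 by (intro mult_pos_pos) auto
  then have "0 < X + (g_theta + H)" using cond2(4) \<open>0 < X\<close> \<open>0 \<le> H\<close> by simp
  moreover have "norm (e t) \<le> X + (g_theta + H)"
    if e: "e \<in> error_solutions A E B C Qx Psi Obar g_s Q I s w theta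
             (voltage_inv E0 R Temp Far VR) L Lam sig F t0"
      and t0: "0 \<le> t0" and init: "norm (e t0) \<le> 1" and t: "t0 \<le> t" for e t0 t
  proof -
    from e obtain x xh thetah sh y Vout
      where e_def: "e = (\<lambda>t. (x t - xh t, theta t - thetah t))"
      and x: "solves_from t0 (plant_rhs A E B Qx Psi Q I s theta x) x"
      and y: "\<forall>t\<ge>t0. y t = voltage_inv E0 R Temp Far VR (Vout t) (I t) \<and> y t = C \<bullet> x t + w t"
      and "sh \<in> {t0..} \<rightarrow> Obar"
      and xh: "solves_from t0 (observer_rhs A E B C L Psi Q I sh y xh thetah) xh"
      and th: "solves_from t0
          (\<lambda>t. adaptation Lam sig F (y t - C \<bullet> xh t) (Psi (sh t)) (thetah t)) thetah"
      unfolding error_solutions_def mem_Collect_eq by (elim exE conjE) (rule that; assumption)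
    then have sh: "sh u \<in> Obar" if "t0 \<le> u" for u
      using that by auto
    have init_x: "norm (x t0 - xh t0) \<le> 1" and init_th: "norm (theta t0 - thetah t0) \<le> 1"
      using init norm_fst_le[of "x t0 - xh t0" "theta t0 - thetah t0"]
        norm_snd_le[of "theta t0 - thetah t0" "x t0 - xh t0"] by (simp_all add: e_def)
    have theta: "norm (theta u) \<le> g_theta" if "t0 \<le> u" for u
      using cond2(5) t0 that by simp
    have thetah: "norm (thetah u) \<le> H" if "t0 \<le> u" for u
      unfolding H_def
    proof (rule trap1[OF th _ _ that])
      show "norm (thetah t0) \<le> max (1 + g_theta) (2 * \<bar>F\<bar> * g_Psi / sig)"
        using norm_triangle_sub[of "thetah t0" "theta t0"] init_th theta[of t0]
        by (simp add: norm_minus_commute le_max_iff_disj)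
    qed (rule adaptation_inward[OF design(2,1) Psi_bound[OF sh]], auto)
    have state: "norm (x t - xh t) \<le> X"
      unfolding X_def
    proof (rule trap2[OF solves_from_diff[OF x xh] _ _ t])
      show "norm (x t0 - xh t0) \<le> max 1 (2 * kap / beta)" using init_x by simp
      fix u assume u: "t0 \<le> u" "max 1 (2 * kap / beta) \<le> norm (x u - xh u)"
      define v where "v = x u - xh u"
      define c where "c = Psi (s u) \<bullet> theta u + approx_err Qx Psi (theta u) (s u)
                            - Psi (sh u) \<bullet> thetah u"
      have "0 \<le> u" "s u \<in> Obar" using u(1) t0 crossover(2,4) by auto
      have yu: "y u = C \<bullet> x u + w u" using y u(1) by blast
      have Q: "Q u \<in> {Qm..QM}"
        using flow(1-4) \<open>0 \<le> u\<close> by (auto intro: cINF_lower cSUP_upper)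
      have split: "plant_rhs A E B Qx Psi Q I s theta x u
            - observer_rhs A E B C L Psi Q I sh y xh thetah u
          = (A (Q u) *v v - (C \<bullet> v) *\<^sub>R L) + (c *\<^sub>R E - w u *\<^sub>R L)"
        by (simp add: plant_rhs_def observer_rhs_def v_def c_def yu algebra_simps
            matrix_vector_mult_diff_distrib)
      have "\<bar>Psi (s u) \<bullet> theta u\<bar> \<le> g_Psi * g_theta"
        using mult_mono[OF Psi_bound[OF \<open>s u \<in> Obar\<close>] theta[OF u(1)]] cond3(1)
          Cauchy_Schwarz_ineq2[of "Psi (s u)" "theta u"] by simp
      moreover have "\<bar>Psi (sh u) \<bullet> thetah u\<bar> \<le> g_Psi * H"
        using mult_mono[OF Psi_bound[OF sh[OF u(1)]] thetah[OF u(1)]] cond3(1)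
          Cauchy_Schwarz_ineq2[of "Psi (sh u)" "thetah u"] by simp
      moreover have "\<bar>approx_err Qx Psi (theta u) (s u)\<bar> \<le> epsbar"
        using cond2(7) \<open>0 \<le> u\<close> by simp
      ultimately have "\<bar>c\<bar> \<le> del" by (simp add: c_def del_def)
      moreover have "\<bar>w u\<bar> \<le> wbar" using cond1(4) \<open>0 \<le> u\<close> by simp
      moreover have "norm (P *v (c *\<^sub>R E - w u *\<^sub>R L))
          \<le> \<bar>c\<bar> * norm (P *v E) + \<bar>w u\<bar> * norm (P *v L)"
        using norm_triangle_ineq4[of "c *\<^sub>R (P *v E)" "w u *\<^sub>R (P *v L)"]
        by (simp add: matrix_vector_mult_diff_distrib matrix_vector_mult_scaleR)
      ultimately have "norm (P *v (c *\<^sub>R E - w u *\<^sub>R L)) \<le> kap"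
        unfolding kap_def by (smt (verit) mult_right_mono norm_ge_zero)
      then show "(x u - xh u) \<bullet> (P *v (plant_rhs A E B Qx Psi Q I s theta x u
            - observer_rhs A E B C L Psi Q I sh y xh thetah u)) \<le> 0"
        unfolding split v_def[symmetric]
        using u(2) alpha_beta(2)
          observer_lyapunov_decrease[OF lmi[rule_format, OF Q] W(2,1) P gain]
        by (intro decrease_with_disturbance) (auto simp: v_def)
    qed
    have "norm (theta t - thetah t) \<le> g_theta + H"
      using norm_triangle_ineq4[of "theta t" "thetah t"] theta[OF t] thetah[OF t] by simp
    with state show ?thesis
      using norm_Pair_le[of "x t - xh t" "theta t - thetah t"] by (simp add: e_def)
  qed
  ultimately show ?thesis
    unfolding UUB_def
    by (intro exI[of _ "X + (g_theta + H)"] conjI exI[of _ 1] allI impI exI[of _ 0]) auto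
qed

end
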